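(* Let $T>0$, $r>0$, $\rho\ge 0$, $\sigma>0$, $c>0$, and let $\nu$ be a Lévy measure on $\mathbb{R}_0=\mathbb{R}\setminus\{0\}$ with $\lambda:=\nu(\{|z|>1\})<\infty$. Let $M>0$ be a given constant such that $$\beta:=\sqrt{\lambda}\,M-(r+\rho)>0,$$ and let $\alpha\in C^1([0,T])$ be a non-increasing time profile ($\alpha'(t)\le 0$) with $\alpha(0)>0$, satisfying the standing assumptions of the context. If a fixed constant $C_T>0$ satisfies $$C_T<\sup_{t\in[0,T)}\left[e^{\beta t}\alpha(t)\right],$$ then there exists an admissible jump amplitude $\gamma_*$ with $L^2(\nu)$-Lipschitz constant $M$ for which there is no nonnegative lower semicontinuous viscosity supersolution $v^T:\mathbb{R}\times[0,T]\to[0,\infty)$ satisfying both the parabolic integro-differential inequality on $\mathbb{R}\times(0,T)$ (the viscosity supersolution inequality for $\mathcal{L}^\nu$ with jump amplitude $\gamma=\gamma_*$) and the bilateral obstacle condition $$v^T(g,t)-v^T(-g,t)\ge\alpha(t)g-c,\qquad (g,t)\in\mathbb{R}\times[0,T],$$ within the growth class $v^T(g,t)\le C_T(1+|g|)$ for $(g,t)\in\mathbb{R}\times[0,T]$.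
   Context: Standing assumptions on the time profile: $\alpha\in C^1([0,T])$, $\alpha(t)\ge 0$ for all $t\in[0,T]$, $\alpha\not\equiv 0$, $\alpha(T)=0$, and $\alpha'(t)\le 0$ for all $t$. Lévy measure: a Borel measure $\nu$ on $\mathbb{R}_0=\mathbb{R}\setminus\{0\}$ with $\int_{\mathbb{R}_0}\min(1,z^2)\,\nu(dz)<\infty$. Admissible jump amplitude with $L^2(\nu)$-Lipschitz constant $L_\gamma>0$: a function $\gamma:\mathbb{R}\times\mathbb{R}_0\to\mathbb{R}$ such that (1) for every $g\in\mathbb{R}$ the map $z\mapsto\gamma(g,z)$ is Borel measurable on $\mathbb{R}_0$, and for every $z\in\mathbb{R}_0$ the map $g\mapsto\gamma(g,z)$ is continuous; (2) $\int_{\mathbb{R}_0}|\gamma(x,z)-\gamma(y,z)|^2\,\nu(dz)\le L_\gamma^2|x-y|^2$ for all $x,y\in\mathbb{R}$, and $\int_{\mathbb{R}_0}|\gamma(0,z)|^2\,\nu(dz)<\infty$; (3) there is $K_1>0$ with $\sup_{0<|z|\le 1}\frac{|\gamma(g,z)|}{|z|}\le K_1(1+|g|)$ for all $g\in\mathbb{R}$; (4) there is $\epsilon\in(0,1)$ with $\limsup_{|g|\to\infty}\sup_{0<|z|\le1}\frac{|\gamma(g,z)|}{|g|}\le 1-\epsilon$. Operator (for sufficiently smooth $w$): $$\mathcal{L}^{\nu}w=w_t-\rho g\,w_g+\frac{\sigma^2}{2}w_{gg}+\int_{\mathbb{R}_0}\left[w(g+\gamma(g,z),t)-w(g,t)-\gamma(g,z)w_g(g,t)\mathbf{1}_{\{|z|\le1\}}\right]\nu(dz)-rw.$$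 Split test operator: for $\delta\in(0,1)$, $\varphi\in C^{2,1}(\mathbb{R}\times[0,T))$ ($C^2$ in $g$, $C^1$ in $t$) and a function $w$, set $$\mathcal{I}^{1,\delta}[\varphi](g,t):=\int_{0<|z|\le\delta}\left[\varphi(g+\gamma(g,z),t)-\varphi(g,t)-\gamma(g,z)\varphi_g(g,t)\right]\nu(dz),$$ $$\mathcal{I}^{2,\delta}[w,\varphi](g,t):=\int_{|z|>\delta}\left[w(g+\gamma(g,z),t)-w(g,t)-\gamma(g,z)\varphi_g(g,t)\mathbf{1}_{\{|z|\le1\}}\right]\nu(dz),$$ $$\mathcal{L}^{\nu,\delta}[\varphi,w](g,t):=\varphi_t-\rho g\,\varphi_g+\frac{\sigma^2}{2}\varphi_{gg}-r\,w(g,t)+\mathcal{I}^{1,\delta}[\varphi](g,t)+\mathcal{I}^{2,\delta}[w,\varphi](g,t).$$ Viscosity supersolution inequality for $\mathcal{L}^\nu$ on $\mathbb{R}\times(0,T)$: a lower semicontinuous $v:\mathbb{R}\times[0,T]\to\mathbb{R}$ of at most linear growth satisfies it if, whenever $\varphi\in C^{2,1}(\mathbb{R}\times[0,T))$ is such that $v-\varphi$ attains a global minimum over $\mathbb{R}\times[0,T)$ at a point $(g_0,t_0)\in\mathbb{R}\times(0,T)$ with $v(g_0,t_0)=\varphi(g_0,t_0)$, one has $-\mathcal{L}^{\nu,\delta}[\varphi,v](g_0,t_0)\ge 0$ for every $\delta\in(0,1)$. *)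

theory Defs
  imports "HOL-Analysis.Analysis"
begin

text \<open>
  Functions on \<open>\<real> \<times> [0,T]\<close> or \<open>\<real> \<times> [0,T)\<close> are total curried functions \<open>w g t\<close>; their values at
  other times are never inspected.
\<close>

definition C1_on_Icc :: "real \<Rightarrow> (real \<Rightarrow> real) \<Rightarrow> (real \<Rightarrow> real) \<Rightarrow> bool" where
  "C1_on_Icc T \<alpha> \<alpha>' \<longleftrightarrow>
     (\<forall>t\<in>{0..T}. (\<alpha> has_real_derivative \<alpha>' t) (at t within {0..T})) \<and> continuous_on {0..T} \<alpha>'"

definition time_profile :: "real \<Rightarrow> (real \<Rightarrow> real) \<Rightarrow> bool" where
  "time_profile T \<alpha> \<longleftrightarrow>
     (\<exists>\<alpha>'. C1_on_Icc T \<alpha> \<alpha>' \<and> (\<forall>t\<in>{0..T}. \<alpha>' t \<le> 0)) \<and>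
     (\<forall>t\<in>{0..T}. \<alpha> t \<ge> 0) \<and> (\<exists>t\<in>{0..T}. \<alpha> t \<noteq> 0) \<and> \<alpha> T = 0"

text \<open>The underlying space of a Levy measure is the punctured line, not the whole line.\<close>

definition levy_measure :: "real measure \<Rightarrow> bool" where
  "levy_measure \<nu> \<longleftrightarrow>
     sets \<nu> = sets (restrict_space borel (- {0 :: real})) \<and>
     (\<integral>\<^sup>+ z. ennreal (min 1 (z\<^sup>2)) \<partial>\<nu>) < \<infinity>"

text \<open>
  A jump amplitude \<open>\<gamma> g z\<close> is relevant for \<open>z \<noteq> 0\<close> only. Suprema and the limit superior are taken
  in \<^typ>\<open>ereal\<close>, so that they may a priori be infinite; the filter \<^term>\<open>at_infinity\<close>
  on the reals expresses \<open>|g| \<rightarrow> \<infinity>\<close>.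
\<close>

definition admissible_jump :: "real measure \<Rightarrow> real \<Rightarrow> (real \<Rightarrow> real \<Rightarrow> real) \<Rightarrow> bool" where
  "admissible_jump \<nu> L \<gamma> \<longleftrightarrow>
     0 < L \<and>
     (\<forall>g. \<gamma> g \<in> borel_measurable (restrict_space borel (- {0}))) \<and>
     (\<forall>z. z \<noteq> 0 \<longrightarrow> continuous_on UNIV (\<lambda>g. \<gamma> g z)) \<and>
     (\<forall>x y. (\<integral>\<^sup>+ z. ennreal (\<bar>\<gamma> x z - \<gamma> y z\<bar>\<^sup>2) \<partial>\<nu>) \<le> ennreal (L\<^sup>2 * \<bar>x - y\<bar>\<^sup>2)) \<and>
     (\<integral>\<^sup>+ z. ennreal (\<bar>\<gamma> 0 z\<bar>\<^sup>2) \<partial>\<nu>) < \<infinity> \<and>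
     (\<exists>K>0. \<forall>g. (SUP z\<in>{z. 0 < \<bar>z\<bar> \<and> \<bar>z\<bar> \<le> 1}. ereal (\<bar>\<gamma> g z\<bar> / \<bar>z\<bar>)) \<le> ereal (K * (1 + \<bar>g\<bar>))) \<and>
     (\<exists>\<epsilon>. 0 < \<epsilon> \<and> \<epsilon> < 1 \<and>
        Limsup at_infinity (\<lambda>g. SUP z\<in>{z. 0 < \<bar>z\<bar> \<and> \<bar>z\<bar> \<le> 1}. ereal (\<bar>\<gamma> g z\<bar> / \<bar>g\<bar>)) \<le> ereal (1 - \<epsilon>))"

text \<open>
  The class \<open>C\<^sup>2\<^sup>,\<^sup>1(\<real> \<times> [0,T))\<close>: \<open>\<phi>\<close>, \<open>\<phi>\<^sub>g\<close>, \<open>\<phi>\<^sub>g\<^sub>g\<close>, \<open>\<phi>\<^sub>t\<close> exist and are jointly continuous; at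
  \<open>t = 0\<close> the time derivative is one-sided.
\<close>

definition C21 :: "real \<Rightarrow> (real \<Rightarrow> real \<Rightarrow> real) \<Rightarrow> bool" where
  "C21 T \<phi> \<longleftrightarrow>
     (\<exists>\<phi>\<^sub>g \<phi>\<^sub>g\<^sub>g \<phi>\<^sub>t.
        (\<forall>g. \<forall>t\<in>{0..<T}.
           ((\<lambda>x. \<phi> x t) has_real_derivative \<phi>\<^sub>g g t) (at g) \<and>
           ((\<lambda>x. \<phi>\<^sub>g x t) has_real_derivative \<phi>\<^sub>g\<^sub>g g t) (at g) \<and>
           ((\<lambda>s. \<phi> g s) has_real_derivative \<phi>\<^sub>t g t) (at t within {0..<T})) \<and>
        continuous_on (UNIV \<times> {0..<T}) (\<lambda>(g, t). \<phi> g t) \<and>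
        continuous_on (UNIV \<times> {0..<T}) (\<lambda>(g, t). \<phi>\<^sub>g g t) \<and>
        continuous_on (UNIV \<times> {0..<T}) (\<lambda>(g, t). \<phi>\<^sub>g\<^sub>g g t) \<and>
        continuous_on (UNIV \<times> {0..<T}) (\<lambda>(g, t). \<phi>\<^sub>t g t))"

text \<open>
  The Bochner integrals below default to 0 when the integrand is not integrable. This does not
  occur in \<open>visc_supersolution\<close>: for a Levy measure and an admissible \<open>\<gamma>\<close>, a Taylor expansion and
  \<open>\<gamma> g \<in> L\<^sup>2(\<nu>)\<close> give integrability of \<open>I1\<close> for \<open>\<phi>\<close> of class \<open>C21\<close>, and for semicontinuous \<open>w\<close> of
  linear growth the integrand of \<open>I2\<close> is dominated by a multiple of \<open>1 + |\<gamma> g z|\<close> on the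
  \<open>\<nu>\<close>-finite set \<open>|z| > \<delta>\<close>.
\<close>

definition I1 ::
  "real measure \<Rightarrow> (real \<Rightarrow> real \<Rightarrow> real) \<Rightarrow> real \<Rightarrow> (real \<Rightarrow> real \<Rightarrow> real) \<Rightarrow> real \<Rightarrow> real \<Rightarrow> real" where
  "I1 \<nu> \<gamma> \<delta> \<phi> g t =
     (LINT z:{z. 0 < \<bar>z\<bar> \<and> \<bar>z\<bar> \<le> \<delta>}|\<nu>.
        \<phi> (g + \<gamma> g z) t - \<phi> g t - \<gamma> g z * deriv (\<lambda>x. \<phi> x t) g)"

definition I2 ::
  "real measure \<Rightarrow> (real \<Rightarrow> real \<Rightarrow> real) \<Rightarrow> real \<Rightarrow> (real \<Rightarrow> real \<Rightarrow> real) \<Rightarrow> (real \<Rightarrow> real \<Rightarrow> real)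
     \<Rightarrow> real \<Rightarrow> real \<Rightarrow> real" where
  "I2 \<nu> \<gamma> \<delta> w \<phi> g t =
     (LINT z:{z. \<bar>z\<bar> > \<delta>}|\<nu>.
        w (g + \<gamma> g z) t - w g t
          - \<gamma> g z * deriv (\<lambda>x. \<phi> x t) g * indicator {z. \<bar>z\<bar> \<le> 1} z)"

text \<open>
  The split operator is only evaluated at interior times \<open>0 < t < T\<close>, where the two-sided
  \<^const>\<open>deriv\<close> in \<open>t\<close> is the time derivative of a \<open>C21\<close> function.
\<close>

definition split_op ::
  "real measure \<Rightarrow> (real \<Rightarrow> real \<Rightarrow> real) \<Rightarrow> real \<Rightarrow> real \<Rightarrow> real \<Rightarrow> real
     \<Rightarrow> (real \<Rightarrow> real \<Rightarrow> real) \<Rightarrow> (real \<Rightarrow> real \<Rightarrow> real) \<Rightarrow> real \<Rightarrow> real \<Rightarrow> real" where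
  "split_op \<nu> \<gamma> \<rho> \<sigma> r \<delta> \<phi> w g t =
     deriv (\<lambda>s. \<phi> g s) t - \<rho> * g * deriv (\<lambda>x. \<phi> x t) g
       + \<sigma>\<^sup>2 / 2 * deriv (deriv (\<lambda>x. \<phi> x t)) g
       - r * w g t + I1 \<nu> \<gamma> \<delta> \<phi> g t + I2 \<nu> \<gamma> \<delta> w \<phi> g t"

definition lsc_on :: "'a::topological_space set \<Rightarrow> ('a \<Rightarrow> real) \<Rightarrow> bool" where
  "lsc_on S f \<longleftrightarrow> (\<forall>x\<in>S. \<forall>y<f x. \<forall>\<^sub>F x' in at x within S. y < f x')"

definition visc_supersolution ::
  "real \<Rightarrow> real measure \<Rightarrow> (real \<Rightarrow> real \<Rightarrow> real) \<Rightarrow> real \<Rightarrow> real \<Rightarrow> real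
     \<Rightarrow> (real \<Rightarrow> real \<Rightarrow> real) \<Rightarrow> bool" where
  "visc_supersolution T \<nu> \<gamma> \<rho> \<sigma> r v \<longleftrightarrow>
     lsc_on (UNIV \<times> {0..T}) (\<lambda>(g, t). v g t) \<and>
     (\<exists>C. \<forall>g. \<forall>t\<in>{0..T}. \<bar>v g t\<bar> \<le> C * (1 + \<bar>g\<bar>)) \<and>
     (\<forall>\<phi> g\<^sub>0 t\<^sub>0.
        C21 T \<phi> \<and> 0 < t\<^sub>0 \<and> t\<^sub>0 < T \<and> v g\<^sub>0 t\<^sub>0 = \<phi> g\<^sub>0 t\<^sub>0 \<and>
        (\<forall>g. \<forall>t\<in>{0..<T}. v g\<^sub>0 t\<^sub>0 - \<phi> g\<^sub>0 t\<^sub>0 \<le> v g t - \<phi> g t) \<longrightarrow>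
        (\<forall>\<delta>. 0 < \<delta> \<and> \<delta> < 1 \<longrightarrow> - split_op \<nu> \<gamma> \<rho> \<sigma> r \<delta> \<phi> v g\<^sub>0 t\<^sub>0 \<ge> 0))"

end

theory Submission
  imports Defs
begin

text \<open>
  Take the amplitude that stretches the state by a fixed factor at each large jump and does nothing
  at small ones: \<open>\<gamma> g z = k g\<close> for \<open>|z| > 1\<close>, where \<open>\<lambda> = \<nu> {|z| > 1}\<close> and \<open>k = M / \<surd>\<lambda>\<close> makes the
  \<open>L\<^sup>2(\<nu>)\<close>-Lipschitz constant exactly \<open>M\<close>. The operator maps \<open>a(t) g\<close> to
  \<open>(a' + (\<lambda>k - \<rho> - r) a) g = (a' + \<beta>a) g\<close>, and so it maps \<open>A e\<^bsup>-\<beta>t\<^esup> g - c\<close> to \<open>rc > 0\<close>: this is a strict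
  subsolution. If it lies below a nonnegative supersolution \<open>v\<close> during some time interval, then it
  lies below \<open>v\<close> at all earlier positive times (lemma \<open>linear_minorant_backward\<close>).

  The obstacle condition and \<open>v \<ge> 0\<close> give \<open>v g t \<ge> \<alpha> t g - c\<close>. If \<open>C\<^sub>T < A < e\<^bsup>\<beta>t\<^esup> \<alpha> t\<close> at some time,
  then by continuity \<open>A e\<^bsup>-\<beta>t\<^esup> g - c\<close> lies below \<open>v\<close> on an interval of times, hence at all earlier
  positive times \<open>s\<close>. Comparison with \<open>v g s \<le> C\<^sub>T (1 + |g|)\<close> for large \<open>g\<close> yields
  \<open>A e\<^bsup>-\<beta>s\<^esup> \<le> C\<^sub>T\<close> (lemma \<open>linear_growth_slope_le\<close>), and \<open>s \<rightarrow> 0\<close> contradicts \<open>C\<^sub>T < A\<close>.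

  The backward propagation is a maximum principle. Both functions grow linearly, so a quadratic
  penalty with a factor decaying fast in time is subtracted from the linear function in order that a
  minimum of the difference exists; two more penalties in time keep this minimum away from the
  initial time and from the times at which the subsolution property is lost.
\<close>

section \<open>Minima of lower semicontinuous functions\<close>

text \<open>
  If \<open>f\<close> had no minimum, each point \<open>x\<close> of \<open>S\<close> would have a neighbourhood on which \<open>f\<close> exceeds some
  value \<open>f (h x)\<close>. Among the points of a finite subcover take the one with least \<open>f (h x)\<close>: the
  neighbourhood containing its \<open>h x\<close> gives a smaller value.
\<close>

lemma lsc_attains_inf:
  fixes f :: "'a::topological_space \<Rightarrow> real"
  assumes "compact S" "S \<noteq> {}" "lsc_on S f"
  shows "\<exists>x\<in>S. \<forall>y\<in>S. f x \<le> f y"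
proof (rule ccontr)
  assume "\<not> ?thesis"
  then have "\<forall>x\<in>S. \<exists>y\<in>S. f y < f x" by force
  then obtain h where h: "\<And>x. x \<in> S \<Longrightarrow> h x \<in> S \<and> f (h x) < f x" by metis
  have "\<exists>V. open V \<and> x \<in> V \<and> (\<forall>x'\<in>V \<inter> S. f (h x) < f x')" if x: "x \<in> S" for x
  proof -
    have "\<forall>\<^sub>F x' in at x within S. f (h x) < f x'"
      using assms(3) h[OF x] x unfolding lsc_on_def by blast
    then obtain V where "open V" "x \<in> V" "\<forall>x'\<in>V. x' \<noteq> x \<longrightarrow> x' \<in> S \<longrightarrow> f (h x) < f x'"
      unfolding eventually_at_topological by blast
    then show ?thesis using h[OF x] by (metis IntE)
  qed
  then obtain V where V: "\<And>x. x \<in> S \<Longrightarrow> open (V x) \<and> x \<in> V x \<and> (\<forall>x'\<in>V x \<inter> S. f (h x) < f x')"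
    by metis
  obtain C where C: "C \<subseteq> S" "finite C" "S \<subseteq> (\<Union>x\<in>C. V x)"
    by (rule compactE_image[OF assms(1), of S V]) (use V in auto)
  have ne: "C \<noteq> {}" using C assms(2) by auto
  obtain x where x: "x \<in> C" "\<And>y. y \<in> C \<Longrightarrow> f (h x) \<le> f (h y)"
    using arg_min_if_finite(1)[OF C(2) ne, of "\<lambda>y. f (h y)"]
      arg_min_least[OF C(2) ne, of _ "\<lambda>y. f (h y)"] by blast
  then have "h x \<in> S" using C h by auto
  then obtain y where "y \<in> C" "h x \<in> V y" using C by auto
  then have "f (h y) < f (h x)" using V[of y] C \<open>h x \<in> S\<close> by auto
  with x(2)[OF \<open>y \<in> C\<close>] show False by simp
qed

lemma lsc_on_subset: "lsc_on S f \<Longrightarrow> A \<subseteq> S \<Longrightarrow> lsc_on A f"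
  unfolding lsc_on_def by (blast intro: filter_leD[OF at_le])

lemma lsc_on_diff_continuous:
  assumes "lsc_on S f" "continuous_on S h"
  shows "lsc_on S (\<lambda>x. f x - h x)"
  unfolding lsc_on_def
proof (intro ballI allI impI)
  fix x y assume x: "x \<in> S" and y: "y < f x - h x"
  define e where "e = (f x - h x - y) / 2"
  have e: "e > 0" using y by (simp add: e_def)
  have "\<forall>\<^sub>F x' in at x within S. f x - e < f x'"
    using assms(1) x e unfolding lsc_on_def by simp
  moreover have "\<forall>\<^sub>F x' in at x within S. h x' < h x + e"
    using assms(2) x e unfolding continuous_on_def by (auto intro: order_tendstoD)
  ultimately show "\<forall>\<^sub>F x' in at x within S. y < f x' - h x'"
    by eventually_elim (simp add: e_def field_simps)
qed

text \<open>The form of coercivity used below: only a negative minimum is sought.\<close>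

lemma lsc_attains_negative_inf:
  fixes f :: "'a::topological_space \<Rightarrow> real"
  assumes "lsc_on S f" "compact K" "K \<subseteq> S" "\<And>x. x \<in> S - K \<Longrightarrow> 0 \<le> f x" "p \<in> S" "f p < 0"
  obtains x where "x \<in> S" "f x < 0" "\<And>y. y \<in> S \<Longrightarrow> f x \<le> f y"
proof -
  have p: "p \<in> K" using assms(4)[of p] assms(5,6) by force
  then obtain x where x: "x \<in> K" "\<And>y. y \<in> K \<Longrightarrow> f x \<le> f y"
    using lsc_attains_inf[of K f] lsc_on_subset[OF assms(1,3)] assms(2) by blast
  have neg: "f x < 0" using x(2)[OF p] assms(6) by simp
  show ?thesis
  proof
    show "x \<in> S" using x(1) assms(3) by blast
    show "f x < 0" by (rule neg)
    show "f x \<le> f y" if "y \<in> S" for y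
      using x(2)[of y] assms(4)[of y] neg that by (cases "y \<in> K") auto
  qed
qed

section \<open>The stretching jump amplitude\<close>

definition stretch_jump :: "real \<Rightarrow> real \<Rightarrow> real \<Rightarrow> real" where
  "stretch_jump k g z = (if \<bar>z\<bar> > 1 then k * g else 0)"

lemma levy_measure_sets_Collect_abs_gt:
  assumes "levy_measure \<nu>" "d \<ge> 0"
  shows "{z. \<bar>z\<bar> > d} \<in> sets \<nu>"
proof -
  have "{z::real. \<bar>z\<bar> > d} \<in> sets borel"
    by (rule borel_open, rule open_Collect_less) (intro continuous_intros)+
  moreover have "{z. \<bar>z\<bar> > d} \<subseteq> - {0}" using assms(2) by auto
  ultimately have "{z. \<bar>z\<bar> > d} \<in> sets (restrict_space borel (- {0::real}))"
    by (subst sets_restrict_space_iff) auto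
  then show ?thesis using assms(1) by (simp add: levy_measure_def)
qed

lemma admissible_stretch_jump:
  assumes \<nu>: "levy_measure \<nu>" and fin: "emeasure \<nu> {z. \<bar>z\<bar> > 1} < \<infinity>"
    and "M > 0" and kM: "k\<^sup>2 * measure \<nu> {z. \<bar>z\<bar> > 1} = M\<^sup>2"
  shows "admissible_jump \<nu> M (stretch_jump k)"
proof -
  have J: "{z. \<bar>z\<bar> > 1} \<in> sets \<nu>" using levy_measure_sets_Collect_abs_gt[OF \<nu>] by simp
  have meas: "stretch_jump k g \<in> borel_measurable (restrict_space borel (- {0}))" for g
  proof -
    have "{z::real. \<bar>z\<bar> > 1} \<in> sets borel"
      by (rule borel_open, rule open_Collect_less) (intro continuous_intros)+
    then have "(\<lambda>z. k * g * indicator {z::real. \<bar>z\<bar> > 1} z) \<in> borel_measurable borel"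
      by (intro borel_measurable_times borel_measurable_const borel_measurable_indicator)
    moreover have "stretch_jump k g = (\<lambda>z. k * g * indicator {z. \<bar>z\<bar> > 1} z)"
      by (auto simp: stretch_jump_def)
    ultimately show ?thesis by (simp add: measurable_restrict_space1)
  qed
  have cont: "continuous_on UNIV (\<lambda>g. stretch_jump k g z)" for z
    by (cases "\<bar>z\<bar> > 1") (auto simp: stretch_jump_def intro!: continuous_intros)
  have lip: "(\<integral>\<^sup>+ z. ennreal (\<bar>stretch_jump k x z - stretch_jump k y z\<bar>\<^sup>2) \<partial>\<nu>)
      = ennreal (M\<^sup>2 * \<bar>x - y\<bar>\<^sup>2)" for x y
  proof -
    have "(\<integral>\<^sup>+ z. ennreal (\<bar>stretch_jump k x z - stretch_jump k y z\<bar>\<^sup>2) \<partial>\<nu>)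
        = (\<integral>\<^sup>+ z. ennreal ((k * (x - y))\<^sup>2) * indicator {z. \<bar>z\<bar> > 1} z \<partial>\<nu>)"
      by (intro nn_integral_cong) (auto simp: stretch_jump_def indicator_def algebra_simps)
    also have "\<dots> = ennreal ((k * (x - y))\<^sup>2) * ennreal (measure \<nu> {z. \<bar>z\<bar> > 1})"
      using J fin by (subst nn_integral_cmult_indicator) (auto simp: emeasure_eq_ennreal_measure)
    also have "\<dots> = ennreal (k\<^sup>2 * measure \<nu> {z. \<bar>z\<bar> > 1} * \<bar>x - y\<bar>\<^sup>2)"
      by (simp add: ennreal_mult[symmetric] power_mult_distrib mult_ac)
    finally show ?thesis by (simp add: kM)
  qed
  have small: "(SUP z\<in>{z. 0 < \<bar>z\<bar> \<and> \<bar>z\<bar> \<le> 1}. ereal (\<bar>stretch_jump k g z\<bar> / h z)) \<le> 0" for g h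
    by (intro SUP_least) (auto simp: stretch_jump_def zero_ereal_def)
  show ?thesis
    unfolding admissible_jump_def
  proof (intro conjI allI impI)
    show "(\<integral>\<^sup>+ z. ennreal (\<bar>stretch_jump k 0 z\<bar>\<^sup>2) \<partial>\<nu>) < \<infinity>"
      by (simp add: stretch_jump_def if_distrib[of "\<lambda>x. x\<^sup>2"] cong: if_cong)
    show "\<exists>K>0. \<forall>g. (SUP z\<in>{z. 0 < \<bar>z\<bar> \<and> \<bar>z\<bar> \<le> 1}. ereal (\<bar>stretch_jump k g z\<bar> / \<bar>z\<bar>))
        \<le> ereal (K * (1 + \<bar>g\<bar>))"
      by (intro exI[of _ 1] conjI allI order.trans[OF small]) auto
    show "\<exists>\<epsilon>. 0 < \<epsilon> \<and> \<epsilon> < 1 \<and>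
        Limsup at_infinity (\<lambda>g. SUP z\<in>{z. 0 < \<bar>z\<bar> \<and> \<bar>z\<bar> \<le> 1}. ereal (\<bar>stretch_jump k g z\<bar> / \<bar>g\<bar>))
          \<le> ereal (1 - \<epsilon>)"
      by (intro exI[of _ "1/2"] conjI Limsup_bounded always_eventually allI
          order.trans[OF small]) auto
  qed (use \<open>M > 0\<close> meas cont in \<open>simp_all only: lip order.refl\<close>)
qed

text \<open>
  Jumps of size at most 1 do not move the state, and the compensator is cut off at size 1; only a
  multiple of one increment of \<open>w\<close> is left of the nonlocal part, for every \<open>\<delta>\<close>.
\<close>

lemma split_op_stretch_jump:
  assumes \<nu>: "levy_measure \<nu>" and fin: "emeasure \<nu> {z. \<bar>z\<bar> > 1} < \<infinity>" and \<delta>: "0 < \<delta>" "\<delta> < 1"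
  shows "split_op \<nu> (stretch_jump k) \<rho> \<sigma> r \<delta> \<phi> w g t =
     deriv (\<lambda>s. \<phi> g s) t - \<rho> * g * deriv (\<lambda>x. \<phi> x t) g
       + \<sigma>\<^sup>2 / 2 * deriv (deriv (\<lambda>x. \<phi> x t)) g
       - r * w g t + measure \<nu> {z. \<bar>z\<bar> > 1} * (w (g + k * g) t - w g t)"
proof -
  have J: "{z. \<bar>z\<bar> > 1} \<in> sets \<nu>" using levy_measure_sets_Collect_abs_gt[OF \<nu>] by simp
  have "I1 \<nu> (stretch_jump k) \<delta> \<phi> g t = (LINT z:{z. 0 < \<bar>z\<bar> \<and> \<bar>z\<bar> \<le> \<delta>}|\<nu>. 0)"
    unfolding I1_def set_lebesgue_integral_def
    using \<delta> by (intro Bochner_Integration.integral_cong refl)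
      (auto simp: stretch_jump_def indicator_def)
  then have I1: "I1 \<nu> (stretch_jump k) \<delta> \<phi> g t = 0" by (simp add: set_lebesgue_integral_def)
  have "I2 \<nu> (stretch_jump k) \<delta> w \<phi> g t
      = (LINT z|\<nu>. indicator {z. \<bar>z\<bar> > 1} z *\<^sub>R (w (g + k * g) t - w g t))"
    unfolding I2_def set_lebesgue_integral_def
    using \<delta> by (intro Bochner_Integration.integral_cong refl)
      (auto simp: stretch_jump_def indicator_def)
  also have "\<dots> = measure \<nu> {z. \<bar>z\<bar> > 1} * (w (g + k * g) t - w g t)"
    using J fin by simp
  finally show ?thesis using I1 by (simp add: split_op_def)
qed

section \<open>Test functions quadratic in the state\<close>

lemma quadratic_derivs:
  fixes a b q :: real
  defines "f \<equiv> \<lambda>x. a * x - b - q * (1 + x\<^sup>2)"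
  shows "(f has_real_derivative a - 2 * q * g) (at g)"
    and "((\<lambda>x. a - 2 * q * x) has_real_derivative - 2 * q) (at g)"
    and "deriv f g = a - 2 * q * g"
    and "deriv (deriv f) g = - 2 * q"
proof -
  show 1: "(f has_real_derivative a - 2 * q * g) (at g)" for g
    unfolding f_def by (auto intro!: derivative_eq_intros)
  show 2: "((\<lambda>x. a - 2 * q * x) has_real_derivative - 2 * q) (at g)"
    by (auto intro!: derivative_eq_intros)
  show "deriv f g = a - 2 * q * g" using 1 by (rule DERIV_imp_deriv)
  have "deriv f = (\<lambda>x. a - 2 * q * x)" using 1 by (auto intro!: DERIV_imp_deriv)
  then show "deriv (deriv f) g = - 2 * q" using 2 by (simp add: DERIV_imp_deriv)
qed

lemma quadratic_time_deriv:
  fixes a b q :: "real \<Rightarrow> real"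
  assumes "(a has_real_derivative a') (at t within S)" "(b has_real_derivative b') (at t within S)"
    "(q has_real_derivative q') (at t within S)"
  shows "((\<lambda>s. a s * g - b s - q s * (1 + g\<^sup>2)) has_real_derivative
            a' * g - b' - q' * (1 + g\<^sup>2)) (at t within S)"
  using assms by (auto intro!: derivative_eq_intros)

lemma continuous_on_quadratic:
  fixes a b q :: "real \<Rightarrow> real"
  assumes "continuous_on I a" "continuous_on I b" "continuous_on I q"
  shows "continuous_on (UNIV \<times> I) (\<lambda>(g, t). a t * g - b t - q t * (1 + g\<^sup>2))"
proof -
  have snd: "continuous_on (UNIV \<times> I) (\<lambda>p. h (snd p))" if "continuous_on I h"
    for h :: "real \<Rightarrow> real"
    by (rule continuous_on_compose2[OF that]) (auto intro: continuous_intros)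
  show ?thesis
    unfolding case_prod_beta by (intro continuous_intros snd assms)
qed

lemma C21_quadratic:
  fixes a b q :: "real \<Rightarrow> real"
  assumes a: "\<And>t. t \<in> {0..<T} \<Longrightarrow> (a has_real_derivative a' t) (at t)"
    and b: "\<And>t. t \<in> {0..<T} \<Longrightarrow> (b has_real_derivative b' t) (at t)"
    and q: "\<And>t. t \<in> {0..<T} \<Longrightarrow> (q has_real_derivative q' t) (at t)"
    and cont: "continuous_on {0..<T} a'" "continuous_on {0..<T} b'" "continuous_on {0..<T} q'"
  shows "C21 T (\<lambda>g t. a t * g - b t - q t * (1 + g\<^sup>2))"
proof -
  have cabq: "continuous_on {0..<T} a" "continuous_on {0..<T} b" "continuous_on {0..<T} q"
    using a b q by (meson DERIV_continuous continuous_at_imp_continuous_on)+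
  have snd: "continuous_on (UNIV \<times> {0..<T}) (\<lambda>p. h (snd p))" if "continuous_on {0..<T} h"
    for h :: "real \<Rightarrow> real"
    by (rule continuous_on_compose2[OF that]) (auto intro: continuous_intros)
  let ?f = "\<lambda>g t. a t * g - b t - q t * (1 + g\<^sup>2)"
  let ?fg = "\<lambda>g t. a t - 2 * q t * g"
  let ?fgg = "\<lambda>g t. - 2 * q t"
  let ?ft = "\<lambda>g t. a' t * g - b' t - q' t * (1 + g\<^sup>2)"
  have "((\<lambda>x. ?f x t) has_real_derivative ?fg g t) (at g) \<and>
      ((\<lambda>x. ?fg x t) has_real_derivative ?fgg g t) (at g) \<and>
      ((\<lambda>s. ?f g s) has_real_derivative ?ft g t) (at t within {0..<T})" if t: "t \<in> {0..<T}" for g t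
  proof (intro conjI)
    show "((\<lambda>s. ?f g s) has_real_derivative ?ft g t) (at t within {0..<T})"
      using a[OF t] b[OF t] q[OF t]
      by (intro quadratic_time_deriv) (rule DERIV_subset[OF _ subset_UNIV], assumption)+
  qed (rule quadratic_derivs)+
  moreover have "continuous_on (UNIV \<times> {0..<T}) (\<lambda>(g, t). ?f g t)"
    by (rule continuous_on_quadratic[OF cabq])
  moreover have "continuous_on (UNIV \<times> {0..<T}) (\<lambda>(g, t). ?fg g t)"
    unfolding case_prod_beta by (intro continuous_intros snd cabq)
  moreover have "continuous_on (UNIV \<times> {0..<T}) (\<lambda>(g, t). ?fgg g t)"
    unfolding case_prod_beta by (intro continuous_intros snd cabq)
  moreover have "continuous_on (UNIV \<times> {0..<T}) (\<lambda>(g, t). ?ft g t)"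
    by (rule continuous_on_quadratic[OF cont])
  ultimately show ?thesis
    unfolding C21_def
    by (intro exI[of _ ?fg] exI[of _ ?fgg] exI[of _ ?ft]) blast
qed

lemma DERIV_pos_part_square:
  "((\<lambda>t::real. (max 0 (t - s))\<^sup>2) has_real_derivative 2 * max 0 (t - s)) (at t)"
proof (cases "t = s")
  case True
  have bound: "norm ((max 0 h)\<^sup>2 / h) \<le> norm h * 1" for h :: real
    by (cases "h > 0") (simp_all add: power2_eq_square max_def)
  have "((\<lambda>h::real. (max 0 h)\<^sup>2 / h) \<longlongrightarrow> 0) (at 0)"
    by (rule tendsto_0_le[OF tendsto_ident_at always_eventually[OF allI[OF bound]]])
  then show ?thesis using True by (simp add: DERIV_def)
next
  case False
  show ?thesis
  proof (cases "t < s")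
    case True
    have "((\<lambda>t::real. 0) has_real_derivative 2 * max 0 (t - s)) (at t)" using True by simp
    then show ?thesis
      by (rule has_field_derivative_transform_within_open[of _ _ _ "{..<s}"]) (use True in auto)
  next
    case nless: False
    have "((\<lambda>t. (t - s)\<^sup>2) has_real_derivative 2 * max 0 (t - s)) (at t)"
      using nless by (auto intro!: derivative_eq_intros)
    then show ?thesis
      by (rule has_field_derivative_transform_within_open[of _ _ _ "{s<..}"])
        (use nless False in auto)
  qed
qed

section \<open>Backward propagation of linear minorants\<close>

text \<open>
  It suffices that \<open>v - \<phi>\<close> has a global minimum at the point: adding the minimal value \<open>m\<close> to \<open>\<phi>\<close>
  makes the two functions touch there and changes no derivative. The zeroth-order and nonlocal terms
  involve \<open>v\<close> only, because small jumps, on which \<open>\<phi>\<close> would be evaluated, do not move the state.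
\<close>

lemma visc_supersolution_touched:
  assumes super: "visc_supersolution T \<nu> (stretch_jump k) \<rho> \<sigma> r v"
    and \<nu>: "levy_measure \<nu>" and fin: "emeasure \<nu> {z. \<bar>z\<bar> > 1} < \<infinity>"
    and a: "\<And>t. t \<in> {0..<T} \<Longrightarrow> (a has_real_derivative a' t) (at t)"
    and b: "\<And>t. t \<in> {0..<T} \<Longrightarrow> (b has_real_derivative b' t) (at t)"
    and q: "\<And>t. t \<in> {0..<T} \<Longrightarrow> (q has_real_derivative q' t) (at t)"
    and cont: "continuous_on {0..<T} a'" "continuous_on {0..<T} b'" "continuous_on {0..<T} q'"
    and t0: "0 < t0" "t0 < T"
    and touch: "\<And>g t. t \<in> {0..<T} \<Longrightarrow>
        v g0 t0 - (a t0 * g0 - b t0 - q t0 * (1 + g0\<^sup>2)) \<le> v g t - (a t * g - b t - q t * (1 + g\<^sup>2))"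
  shows "a' t0 * g0 - b' t0 - q' t0 * (1 + g0\<^sup>2) - \<rho> * g0 * (a t0 - 2 * q t0 * g0) - \<sigma>\<^sup>2 * q t0
      - r * v g0 t0 + measure \<nu> {z. \<bar>z\<bar> > 1} * (v (g0 + k * g0) t0 - v g0 t0) \<le> 0"
proof -
  define m where "m = v g0 t0 - (a t0 * g0 - b t0 - q t0 * (1 + g0\<^sup>2))"
  define \<phi> where "\<phi> = (\<lambda>g t. a t * g - (b t - m) - q t * (1 + g\<^sup>2))"
  have bm: "((\<lambda>t. b t - m) has_real_derivative b' t) (at t)" if "t \<in> {0..<T}" for t
    using b[OF that] by (auto intro!: derivative_eq_intros)
  have "C21 T \<phi>" unfolding \<phi>_def by (rule C21_quadratic[OF a bm q cont])
  moreover have "v g0 t0 = \<phi> g0 t0" by (simp add: \<phi>_def m_def)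
  moreover have "v g0 t0 - \<phi> g0 t0 \<le> v g t - \<phi> g t" if "t \<in> {0..<T}" for g t
    using touch[OF that, of g] by (simp add: \<phi>_def)
  ultimately have "\<forall>\<delta>. 0 < \<delta> \<and> \<delta> < 1 \<longrightarrow>
      - split_op \<nu> (stretch_jump k) \<rho> \<sigma> r \<delta> \<phi> v g0 t0 \<ge> 0"
    using super t0 unfolding visc_supersolution_def by blast
  from this[rule_format, of "1/2"] have "split_op \<nu> (stretch_jump k) \<rho> \<sigma> r (1/2) \<phi> v g0 t0 \<le> 0"
    by simp
  moreover have "deriv (\<lambda>s. \<phi> g0 s) t0 = a' t0 * g0 - b' t0 - q' t0 * (1 + g0\<^sup>2)"
    unfolding \<phi>_def using t0 by (intro DERIV_imp_deriv quadratic_time_deriv a bm q) auto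
  ultimately show ?thesis
    by (subst (asm) split_op_stretch_jump[OF \<nu> fin]) (simp_all add: \<phi>_def quadratic_derivs)
qed

text \<open>
  If the linear function exceeded \<open>v\<close> at some time in \<open>(0, t\<^sub>1]\<close>, so would the barrier
  \<open>\<phi> = A e\<^bsup>-\<beta>t\<^esup> g - c - \<eta> / (t + \<tau>) - (\<epsilon> e\<^bsup>-Kt\<^esup> + D ((t - t\<^sub>1)\<^sup>+)\<^sup>2) (1 + g\<^sup>2)\<close>
  for small \<open>\<epsilon>\<close> and \<open>\<eta>\<close>. The \<open>\<epsilon>\<close> term makes \<open>v - \<phi>\<close> coercive, so that it has a minimum, which is
  negative. On \<open>[t\<^sub>1, t\<^sub>2]\<close> the barrier is below the linear function and hence below \<open>v\<close>; large \<open>D\<close>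
  makes it nonpositive after \<open>t\<^sub>2\<close>, and small \<open>\<tau>\<close> makes it nonpositive at time \<open>0\<close>. The minimum is
  therefore taken at a time in \<open>(0, t\<^sub>1)\<close>. There the \<open>D\<close> term vanishes and \<open>\<phi>\<close> is a subsolution:
  both time penalties are nonincreasing in \<open>t\<close>, and \<open>K\<close> outweighs the growth that diffusion and
  jumps give to \<open>1 + g\<^sup>2\<close>. As \<open>r v < r \<phi>\<close> at the minimum, the supersolution inequality for \<open>v\<close>
  fails.
\<close>

lemma linear_minorant_backward:
  fixes v :: "real \<Rightarrow> real \<Rightarrow> real"
  assumes \<nu>: "levy_measure \<nu>" and fin: "emeasure \<nu> {z. \<bar>z\<bar> > 1} < \<infinity>"
    and lam: "lam = measure \<nu> {z. \<bar>z\<bar> > 1}"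
    and r: "r > 0" and \<rho>: "\<rho> \<ge> 0" and c: "c \<ge> 0" and k: "k \<ge> 0" and A: "A > 0"
    and \<beta>: "\<beta> = lam * k - (r + \<rho>)" "\<beta> \<ge> 0"
    and super: "visc_supersolution T \<nu> (stretch_jump k) \<rho> \<sigma> r v"
    and nonneg: "\<And>g t. t \<in> {0..T} \<Longrightarrow> 0 \<le> v g t"
    and t12: "t1 < t2" "t2 < T"
    and minorant: "\<And>g t. t \<in> {t1..t2} \<Longrightarrow> A * exp (- \<beta> * t) * g - c \<le> v g t"
    and s: "0 < s" "s \<le> t1"
  shows "A * exp (- \<beta> * s) * g - c \<le> v g s"
proof (rule ccontr)
  assume contra: "\<not> ?thesis"
  \<comment> \<open>Each of the two penalties that are present at time \<open>s\<close> may use a third of the gap \<open>\<Delta>\<close>.\<close>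
  define \<Delta> where "\<Delta> = A * exp (- \<beta> * s) * g - c - v g s"
  have \<Delta>: "\<Delta> > 0" using contra by (simp add: \<Delta>_def)
  define \<epsilon> where "\<epsilon> = \<Delta> / 3 / (1 + g\<^sup>2)"
  define \<eta> where "\<eta> = \<Delta> * s / 3"
  \<comment> \<open>The maximum of \<open>A x - \<epsilon> x\<^sup>2\<close> is \<open>A\<^sup>2 / (4 \<epsilon>)\<close>, which \<open>\<eta> / \<tau>\<close> has to offset at time \<open>0\<close>.\<close>
  define \<tau> where "\<tau> = 4 * \<epsilon> * \<eta> / A\<^sup>2"
  define K where "K = \<sigma>\<^sup>2 + lam * ((1 + k)\<^sup>2 - 1)"
  define D where "D = A / (t2 - t1)\<^sup>2"
  have g2: "1 + g\<^sup>2 > 0" by (simp add: add_pos_nonneg)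
  have \<epsilon>: "\<epsilon> > 0" using \<Delta> g2 by (simp add: \<epsilon>_def)
  have \<eta>: "\<eta> > 0" using \<Delta> s by (simp add: \<eta>_def)
  have \<tau>: "\<tau> > 0" using \<epsilon> \<eta> A by (simp add: \<tau>_def)
  have lam0: "lam \<ge> 0" by (simp add: lam)
  have "(1 + k)\<^sup>2 \<ge> 1" using k by simp
  then have K: "K \<ge> 0" using lam0 by (simp add: K_def)
  have D: "D > 0" using A t12 by (simp add: D_def)
  define a where "a = (\<lambda>t. A * exp (- \<beta> * t))"
  define b where "b = (\<lambda>t. c + \<eta> / (t + \<tau>))"
  define q where "q = (\<lambda>t. \<epsilon> * exp (- K * t) + D * (max 0 (t - t1))\<^sup>2)"
  define a' where "a' = (\<lambda>t. - \<beta> * a t)"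
  define b' where "b' = (\<lambda>t. - \<eta> / (t + \<tau>)\<^sup>2)"
  define q' where "q' = (\<lambda>t. - K * \<epsilon> * exp (- K * t) + D * (2 * max 0 (t - t1)))"
  define \<phi> where "\<phi> = (\<lambda>g t. a t * g - b t - q t * (1 + g\<^sup>2))"
  have da: "(a has_real_derivative a' t) (at t)" for t
    unfolding a_def a'_def by (auto intro!: derivative_eq_intros)
  have db: "(b has_real_derivative b' t) (at t)" if "t \<ge> 0" for t
    unfolding b_def b'_def using that \<tau>
    by (auto intro!: derivative_eq_intros simp: power2_eq_square)
  have dq: "(q has_real_derivative q' t) (at t)" for t
    unfolding q_def q'_def
    by (rule derivative_eq_intros DERIV_pos_part_square refl | simp)+
  have ca: "continuous_on S a" for S
    unfolding a_def by (intro continuous_intros)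
  have cq: "continuous_on S q" for S
    unfolding q_def by (intro continuous_intros)
  have cb: "continuous_on {0..T} b"
    unfolding b_def using \<tau> by (intro continuous_intros) auto
  have ca': "continuous_on {0..<T} a'" unfolding a'_def by (intro continuous_intros ca)
  have cb': "continuous_on {0..<T} b'" unfolding b'_def using \<tau> by (intro continuous_intros) auto
  have cq': "continuous_on {0..<T} q'" unfolding q'_def by (intro continuous_intros)

  have a_pos: "a t > 0" for t using A by (simp add: a_def)
  have a_le: "a t \<le> A" if "t \<ge> 0" for t 
    using A mult_nonneg_nonneg[OF \<beta>(2) that] by (simp add: a_def)
  have ag_le: "a t * x \<le> A * \<bar>x\<bar>" if "t \<ge> 0" for t x
  proof -
    have "a t * x \<le> a t * \<bar>x\<bar>" using a_pos[of t] by (intro mult_left_mono) auto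
    also have "\<dots> \<le> A * \<bar>x\<bar>" using a_le[OF that] by (intro mult_right_mono) auto
    finally show ?thesis .
  qed
  have b_ge: "b t \<ge> 0" if "t \<ge> 0" for t using that \<eta> \<tau> c by (simp add: b_def)
  have q_ge: "q t \<ge> \<epsilon> * exp (- K * T)" if "t \<le> T" for t
  proof -
    have "exp (- K * T) \<le> exp (- K * t)" 
      using mult_left_mono[OF that K] by simp
    then have "\<epsilon> * exp (- K * T) \<le> \<epsilon> * exp (- K * t)" using \<epsilon> by (intro mult_left_mono) auto
    moreover have "0 \<le> D * (max 0 (t - t1))\<^sup>2" using D by simp
    ultimately show ?thesis unfolding q_def by linarith
  qed
  have q_pos: "q t > 0" for t
    unfolding q_def using \<epsilon> D by (intro add_pos_nonneg mult_pos_pos mult_nonneg_nonneg) auto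
  have q_pos': "0 \<le> q t * (1 + x\<^sup>2)" for t x using q_pos[of t] by simp

  have exceeds: "v g s < \<phi> g s"
  proof -
    have "q s \<le> \<epsilon>" using s \<epsilon> mult_nonneg_nonneg[OF K, of s] by (simp add: q_def max_def)
    then have "q s * (1 + g\<^sup>2) \<le> \<epsilon> * (1 + g\<^sup>2)" using g2 by simp
    also have "\<dots> = \<Delta> / 3"
    proof -
      have "x / w * w = x" if "w \<noteq> 0" for x w :: real using that by simp
      then show ?thesis unfolding \<epsilon>_def by this (use g2 in linarith)
    qed
    finally have "q s * (1 + g\<^sup>2) \<le> \<Delta> / 3" .
    moreover have "\<eta> / (s + \<tau>) \<le> \<eta> / s" using \<eta> \<tau> s by (intro divide_left_mono) auto
    then have "b s \<le> c + \<Delta> / 3" using s by (simp add: b_def \<eta>_def)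
    moreover have "a s * g - c = v g s + \<Delta>" by (simp add: \<Delta>_def a_def)
    moreover have "\<phi> g s = (a s * g - c) - (b s - c) - q s * (1 + g\<^sup>2)" by (simp add: \<phi>_def)
    ultimately show ?thesis using \<Delta> by argo
  qed
  have at_start: "\<phi> x 0 \<le> 0" for x
  proof -
    have "0 \<le> (A - 2 * \<epsilon> * x)\<^sup>2 / (4 * \<epsilon>)" using \<epsilon> by simp
    also have "\<dots> = A\<^sup>2 / (4 * \<epsilon>) - A * x + \<epsilon> * x\<^sup>2"
      using \<epsilon> by (simp add: field_simps power2_eq_square)
    finally have "A * x \<le> A\<^sup>2 / (4 * \<epsilon>) + \<epsilon> * x\<^sup>2" by simp
    moreover have "\<eta> / \<tau> = A\<^sup>2 / (4 * \<epsilon>)" using \<epsilon> \<eta> A by (simp add: \<tau>_def)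
    moreover have "q 0 = \<epsilon>" using s by (simp add: q_def max_def)
    moreover have "a 0 = A" "b 0 = c + \<eta> / \<tau>" by (simp_all add: a_def b_def)
    moreover have "\<epsilon> * (1 + x\<^sup>2) = \<epsilon> + \<epsilon> * x\<^sup>2" by (simp add: algebra_simps)
    ultimately show ?thesis using c \<epsilon> by (simp add: \<phi>_def)
  qed
  have late: "\<phi> x t \<le> v x t" if t: "t1 \<le> t" "t \<le> T" for x t
  proof (cases "t \<le> t2")
    case True
    then have "A * exp (- \<beta> * t) * x - c \<le> v x t" using minorant t by simp
    moreover have "\<eta> / (t + \<tau>) \<ge> 0" using t s \<eta> \<tau> by simp
    ultimately show ?thesis using q_pos'[of t x] unfolding \<phi>_def a_def b_def by linarith
  next
    case False
    have "A = D * (t2 - t1)\<^sup>2" using t12 by (simp add: D_def)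
    also have "\<dots> \<le> D * (t - t1)\<^sup>2" using False t12 D by (intro mult_left_mono power_mono) auto
    also have "\<dots> \<le> q t" using \<epsilon> t by (simp add: q_def max_def)
    finally have "A * (1 + x\<^sup>2) \<le> q t * (1 + x\<^sup>2)" by (intro mult_right_mono) auto
    moreover have "\<bar>x\<bar> \<le> 1 + x\<^sup>2"
      using zero_le_power2[of "\<bar>x\<bar> - 1"] by (simp add: power2_eq_square algebra_simps)
    then have "A * \<bar>x\<bar> \<le> A * (1 + x\<^sup>2)" using A by (intro mult_left_mono) auto
    moreover have "a t * x \<le> A * \<bar>x\<bar>" "b t \<ge> 0" using ag_le b_ge t s by auto
    ultimately have "\<phi> x t \<le> 0" unfolding \<phi>_def by linarith
    then show ?thesis using nonneg[of t x] t s by simp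
  qed
  define R where "R = A / (\<epsilon> * exp (- K * T))"
  have far: "\<phi> x t \<le> 0" if t: "0 \<le> t" "t \<le> T" and x: "\<bar>x\<bar> \<ge> R" for x t
  proof -
    have "A * \<bar>x\<bar> = \<epsilon> * exp (- K * T) * R * \<bar>x\<bar>" using \<epsilon> by (simp add: R_def)
    also have "\<dots> \<le> \<epsilon> * exp (- K * T) * \<bar>x\<bar> * \<bar>x\<bar>"
      using x \<epsilon> by (intro mult_right_mono mult_left_mono) auto
    also have "\<dots> \<le> \<epsilon> * exp (- K * T) * (1 + x\<^sup>2)" using \<epsilon> by (simp add: power2_eq_square mult.assoc)
    also have "\<dots> \<le> q t * (1 + x\<^sup>2)" using q_ge[OF t(2)] by (intro mult_right_mono) auto
    finally show ?thesis using ag_le[OF t(1), of x] b_ge[OF t(1)] unfolding \<phi>_def by linarith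
  qed

  obtain p where p: "p \<in> UNIV \<times> {0..T}" "(\<lambda>(x, t). v x t) p - (\<lambda>(x, t). \<phi> x t) p < 0"
    "\<And>y. y \<in> UNIV \<times> {0..T} \<Longrightarrow>
      (\<lambda>(x, t). v x t) p - (\<lambda>(x, t). \<phi> x t) p \<le> (\<lambda>(x, t). v x t) y - (\<lambda>(x, t). \<phi> x t) y"
  proof (rule lsc_attains_negative_inf)
    show "lsc_on (UNIV \<times> {0..T}) (\<lambda>y. (\<lambda>(x, t). v x t) y - (\<lambda>(x, t). \<phi> x t) y)"
      using super continuous_on_quadratic[OF ca cb cq]
      by (intro lsc_on_diff_continuous) (simp_all add: visc_supersolution_def \<phi>_def)
    show "compact ({- R..R} \<times> {0..T})" by (intro compact_Times) auto
    show "0 \<le> (\<lambda>(x, t). v x t) y - (\<lambda>(x, t). \<phi> x t) y"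
      if "y \<in> UNIV \<times> {0..T} - {- R..R} \<times> {0..T}" for y
    proof -
      obtain x t where y: "y = (x, t)" by (cases y)
      then have "0 \<le> t" "t \<le> T" "\<bar>x\<bar> \<ge> R" using that by auto
      then show ?thesis using far[of t x] nonneg[of t x] y by simp
    qed
    show "(g, s) \<in> UNIV \<times> {0..T}" using s t12 by auto
    show "(\<lambda>(x, t). v x t) (g, s) - (\<lambda>(x, t). \<phi> x t) (g, s) < 0" using exceeds by simp
  qed auto
  obtain g0 t0 where p_eq: "p = (g0, t0)" by (cases p)
  have neg: "v g0 t0 < \<phi> g0 t0" and t0T: "0 \<le> t0" "t0 \<le> T" using p p_eq by auto
  have mini: "v g0 t0 - \<phi> g0 t0 \<le> v x t - \<phi> x t" if "t \<in> {0..T}" for x t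
    using p(3)[of "(x, t)"] p_eq that by simp
  have "t0 \<noteq> 0" using at_start[of g0] nonneg[of 0 g0] neg t0T by force
  then have t0: "0 < t0" using t0T by simp
  have t01: "t0 < t1" using late[of t0 g0] neg t0T by force
  have t0T': "t0 < T" using t01 t12 by simp

  have "a' t0 * g0 - b' t0 - q' t0 * (1 + g0\<^sup>2) - \<rho> * g0 * (a t0 - 2 * q t0 * g0) - \<sigma>\<^sup>2 * q t0
      - r * v g0 t0 + lam * (v (g0 + k * g0) t0 - v g0 t0) \<le> 0"
    unfolding lam
    using mini by (intro visc_supersolution_touched[OF super \<nu> fin da db dq ca' cb' cq' t0 t0T'])
      (auto simp: \<phi>_def)
  moreover have "lam * (v (g0 + k * g0) t0 - v g0 t0) \<ge> lam * (\<phi> (g0 + k * g0) t0 - \<phi> g0 t0)"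
    using mini[of t0 "g0 + k * g0"] t0T lam0 by (intro mult_left_mono) auto
  moreover have "r * v g0 t0 < r * \<phi> g0 t0" using neg r by simp
  ultimately have "a' t0 * g0 - b' t0 - q' t0 * (1 + g0\<^sup>2) - \<rho> * g0 * (a t0 - 2 * q t0 * g0)
      - \<sigma>\<^sup>2 * q t0 - r * \<phi> g0 t0 + lam * (\<phi> (g0 + k * g0) t0 - \<phi> g0 t0) < 0" by linarith
  moreover have "\<phi> (g0 + k * g0) t0 - \<phi> g0 t0 = a t0 * k * g0 - q t0 * ((1 + k)\<^sup>2 - 1) * g0\<^sup>2"
    unfolding \<phi>_def by (simp add: algebra_simps power2_eq_square)
  moreover have "q' t0 = - K * q t0" using t01 by (simp add: q'_def q_def max_def)
  moreover have "lam * k = \<beta> + r + \<rho>" using \<beta> by simp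
  \<comment> \<open>The operator applied to \<open>\<phi>\<close>, as a vanishing linear term plus nonnegative terms.\<close>
  moreover have "a' t0 * g0 - b' t0 - (- K * q t0) * (1 + g0\<^sup>2) - \<rho> * g0 * (a t0 - 2 * q t0 * g0)
      - \<sigma>\<^sup>2 * q t0 - r * \<phi> g0 t0 + lam * (a t0 * k * g0 - q t0 * ((1 + k)\<^sup>2 - 1) * g0\<^sup>2)
    = (lam * k - \<beta> - r - \<rho>) * a t0 * g0 + (- b' t0 + r * b t0) + (2 * \<rho> * g0\<^sup>2 * q t0)
      + r * (q t0 * (1 + g0\<^sup>2)) + q t0 * (\<sigma>\<^sup>2 * g0\<^sup>2 + lam * ((1 + k)\<^sup>2 - 1))"
    unfolding \<phi>_def K_def a'_def by (simp add: algebra_simps power2_eq_square)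
  moreover have "- b' t0 + r * b t0 \<ge> 0"
    using b_ge[of t0] t0T \<eta> \<tau> r by (simp add: b'_def)
  moreover have "2 * \<rho> * g0\<^sup>2 * q t0 \<ge> 0" using \<rho> q_pos[of t0] by simp
  moreover have "r * (q t0 * (1 + g0\<^sup>2)) \<ge> 0" using r q_pos'[of t0 g0] by simp
  moreover have "q t0 * (\<sigma>\<^sup>2 * g0\<^sup>2 + lam * ((1 + k)\<^sup>2 - 1)) \<ge> 0"
    using q_pos[of t0] lam0 \<open>(1 + k)\<^sup>2 \<ge> 1\<close> by simp
  ultimately show False by simp
qed

section \<open>Nonexistence below the critical growth constant\<close>

lemma linear_growth_slope_le:
  fixes a b C :: real
  assumes "\<And>g. g \<ge> 0 \<Longrightarrow> a * g - b \<le> C * (1 + g)"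
  shows "a \<le> C"
proof (rule ccontr)
  assume "\<not> a \<le> C"
  then have d: "a - C > 0" by simp
  define g where "g = (\<bar>C + b\<bar> + 1) / (a - C)"
  have "(a - C) * g = \<bar>C + b\<bar> + 1" using d by (simp add: g_def)
  moreover have "a * g - b \<le> C * (1 + g)" using assms[of g] d by (simp add: g_def)
  ultimately show False by (simp add: algebra_simps)
qed

theorem corollary3p7:
  fixes T r \<rho> \<sigma> c M \<beta> lam C_T :: real
    and \<nu> :: "real measure" and \<alpha> :: "real \<Rightarrow> real"
  assumes "T > 0" and "r > 0" and "\<rho> \<ge> 0" and "\<sigma> > 0" and "c > 0"
    and "levy_measure \<nu>"
    and "emeasure \<nu> {z. \<bar>z\<bar> > 1} < \<infinity>"
    and "lam = measure \<nu> {z. \<bar>z\<bar> > 1}"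
    and "M > 0"
    and "\<beta> = sqrt lam * M - (r + \<rho>)" and "\<beta> > 0"
    and "time_profile T \<alpha>" and "\<alpha> 0 > 0"
    and "C_T > 0" and "C_T < (SUP t\<in>{0..<T}. exp (\<beta> * t) * \<alpha> t)"
  shows "\<exists>\<gamma>. admissible_jump \<nu> M \<gamma> \<and>
    \<not> (\<exists>v :: real \<Rightarrow> real \<Rightarrow> real.
          (\<forall>g. \<forall>t\<in>{0..T}. 0 \<le> v g t) \<and>
          visc_supersolution T \<nu> \<gamma> \<rho> \<sigma> r v \<and>
          (\<forall>g. \<forall>t\<in>{0..T}. v g t - v (- g) t \<ge> \<alpha> t * g - c) \<and>
          (\<forall>g. \<forall>t\<in>{0..T}. v g t \<le> C_T * (1 + \<bar>g\<bar>)))"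
proof -
  have lam: "lam > 0"
  proof (rule ccontr)
    assume "\<not> lam > 0"
    then have "lam = 0" using assms(8) by (simp add: order.antisym)
    then show False using assms(2,3,10,11) by simp
  qed
  define k where "k = M / sqrt lam"
  have k: "k > 0" and kM: "k\<^sup>2 * lam = M\<^sup>2" and lamk: "lam * k = sqrt lam * M"
    using lam assms(9) by (auto simp: k_def power_divide real_div_sqrt field_simps)
  have adm: "admissible_jump \<nu> M (stretch_jump k)"
    using admissible_stretch_jump[OF assms(6,7,9)] kM assms(8) by simp
  have cont: "continuous_on {0..T} (\<lambda>t. exp (\<beta> * t) * \<alpha> t)"
  proof -
    have "continuous_on {0..T} \<alpha>"
      using assms(12) unfolding time_profile_def C1_on_Icc_def
      by (auto intro: DERIV_continuous_on)
    then show ?thesis by (intro continuous_intros)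
  qed
  have "bdd_above ((\<lambda>t. exp (\<beta> * t) * \<alpha> t) ` {0..<T})"
    using compact_continuous_image[OF cont] 
    by (meson atLeastLessThan_subseteq_atLeastAtMost_iff bdd_above_mono bounded_imp_bdd_above
        compact_Icc compact_imp_bounded image_mono order.refl)
  then obtain ts where ts: "ts \<in> {0..<T}" "C_T < exp (\<beta> * ts) * \<alpha> ts"
    using assms(1,15) by (subst (asm) less_cSUP_iff) auto
  then obtain A where A: "C_T < A" "A < exp (\<beta> * ts) * \<alpha> ts" using dense by blast
  have "\<forall>\<^sub>F t in at ts within {0..T}. A < exp (\<beta> * t) * \<alpha> t"
    using cont ts A by (intro order_tendstoD(1)) (auto simp: continuous_on_def)
  then obtain d where d: "d > 0"
    "\<And>t. t \<in> {0..T} \<Longrightarrow> t \<noteq> ts \<Longrightarrow> dist t ts < d \<Longrightarrow> A < exp (\<beta> * t) * \<alpha> t"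
    unfolding eventually_at by blast
  \<comment> \<open>The interval lies to the right of \<open>ts\<close>, so that \<open>t1 > 0\<close> also if \<open>ts = 0\<close>.\<close>
  define e where "e = min d (T - ts) / 2"
  define t1 where "t1 = ts + e / 2"
  define t2 where "t2 = ts + e"
  have e: "e > 0" "e < d" "e < T - ts" using d(1) ts by (auto simp: e_def min_def)
  have t12: "0 < t1" "t1 < t2" "t2 < T" using e ts by (auto simp: t1_def t2_def)
  have above: "A * exp (- \<beta> * t) \<le> \<alpha> t" if "t \<in> {t1..t2}" for t
  proof -
    have "A < exp (\<beta> * t) * \<alpha> t"
      using that e t12 ts by (intro d(2)) (auto simp: dist_real_def t1_def t2_def)
    then have "A * exp (- \<beta> * t) \<le> exp (\<beta> * t) * \<alpha> t * exp (- \<beta> * t)" by simp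
    also have "\<dots> = \<alpha> t" by (simp add: exp_minus field_simps)
    finally show ?thesis .
  qed
  have False if nonneg: "\<forall>g. \<forall>t\<in>{0..T}. 0 \<le> v g t"
    and super: "visc_supersolution T \<nu> (stretch_jump k) \<rho> \<sigma> r v"
    and obstacle: "\<forall>g. \<forall>t\<in>{0..T}. v g t - v (- g) t \<ge> \<alpha> t * g - c"
    and growth: "\<forall>g. \<forall>t\<in>{0..T}. v g t \<le> C_T * (1 + \<bar>g\<bar>)" for v
  proof -
    have minorant: "A * exp (- \<beta> * t) * g - c \<le> v g t" if t: "t \<in> {t1..t2}" for g t
    proof (cases "g \<ge> 0")
      case True
      have tT: "t \<in> {0..T}" using t t12 by auto
      have "A * exp (- \<beta> * t) * g \<le> \<alpha> t * g" using above[OF t] True by (intro mult_right_mono)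
      moreover have "\<alpha> t * g - c \<le> v g t - v (- g) t" "0 \<le> v (- g) t"
        using obstacle nonneg tT by auto
      ultimately show ?thesis by linarith
    next
      case False
      have "A * exp (- \<beta> * t) * g \<le> 0"
        using False A(1) assms(14) by (intro mult_nonneg_nonpos) auto
      moreover have "0 \<le> v g t" using nonneg t t12 by auto
      ultimately show ?thesis using assms(5) by linarith
    qed
    have slope: "A * exp (- \<beta> * s) \<le> C_T" if s: "0 < s" "s \<le> t1" for s
    proof (rule linear_growth_slope_le)
      fix g :: real assume "g \<ge> 0"
      have "A * exp (- \<beta> * s) * g - c \<le> v g s"
        by (rule linear_minorant_backward[OF assms(6,7,8,2,3) _ _ _ _ _ super _ t12(2,3) minorant s])
          (use assms k A nonneg lamk in auto)
      also have "\<dots> \<le> C_T * (1 + g)" 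
        using growth[rule_format, of s g] s t12 \<open>g \<ge> 0\<close> by simp
      finally show "A * exp (- \<beta> * s) * g - c \<le> C_T * (1 + g)" .
    qed
    have "((\<lambda>s. A * exp (- \<beta> * s)) \<longlongrightarrow> A * exp (- \<beta> * 0)) (at_right 0)"
      by (intro tendsto_intros)
    moreover have "\<forall>\<^sub>F s in at_right 0. A * exp (- \<beta> * s) \<le> C_T"
      using eventually_at_right_real[OF t12(1)] by eventually_elim (rule slope; simp)
    ultimately have "A * exp (- \<beta> * 0) \<le> C_T" by (rule tendsto_upperbound) simp
    then show False using A(1) by simp
  qed
  then show ?thesis using adm by blast
qed

end
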